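(* Let $G$ be a discrete supersolvable group and let $F$ denote its Fitting subgroup. Let $H$ be a subgroup of $G$ and let $\chi: H \to \mathbb{C}^\times$ be a character of $H$ such that for every $g \in N_G\big(\sqrt[F]{H\cap F}\big) \setminus H$ we have $\chi^g \neq \chi$ on $H^g \cap H$ (i.e. the restrictions of $\chi^g$ and $\chi$ to $H^g\cap H$ are different). Then $\mathrm{Ind}_H^G(\chi)$ is Schur irreducible.
   Context: A group $G$ is supersolvable if there is a finite series $1 = N_{k+1} \subseteq N_k \subseteq \cdots \subseteq N_0 = G$ with every $N_i$ normal in $G$ and every quotient $N_i/N_{i+1}$ cyclic (finite or infinite). "Discrete" means that $G$ is regarded as an abstract group with no further topology. The Fitting subgroup $F$ of $G$ is the subgroup generated by all normal nilpotent subgroups of $G$; for $G$ supersolvable it is a normal nilpotent subgroup. Representations are abstract (possibly infinite dimensional, not necessarily unitary) complex representations. A character of a group is a one-dimensional complex representation, i.e. a homomorphism to $\mathbb{C}^\times$. For a subgroup $K$ of a group $L$, the radical of $K$ in $L$ is the set $\sqrt[L]{K} = \{ g \in L \mid g^n \in K \text{ for some integer } n \geq 1\}$. (When $L$ is a finitely generated nilpotent group, such as $L=F$, this is a subgroup of $L$.) $N_G(K)$ denotes the normalizer of $K$ in $G$. For $g \in G$, $H^g = g^{-1}Hg$ and $\chi^g : H^g \to \mathbb{C}^\times$ is defined by $\chi^g(g^{-1}hg) = \chi(h)$ for $h\in H$. Induction is finite (compact) induction: for a representation $(\rho, W)$ of a subgroup $H\le G$, $\mathrm{Ind}_H^G(\rho)$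 is the space of functions $f : G \to W$ with $f(hg) = \rho(h) f(g)$ for all $h \in H$, $g \in G$, and with support contained in a finite union of right cosets $Hx$ of $H$ in $G$, on which $G$ acts by right translation $(g\cdot f)(x) = f(xg)$. A representation $V$ of $G$ is Schur irreducible if $\mathrm{End}_G(V)$ (the space of $G$-linear endomorphisms of $V$) is one-dimensional over $\mathbb{C}$. *)

theory Defs
  imports
    Complex_Main
    "HOL-Library.Function_Algebras"
    "HOL-Algebra.Group_Action"
    "HOL-Algebra.Generated_Groups"
    "HOL-Algebra.Elementary_Groups"
begin

section \<open>Groups\<close>

definition supersolvable :: "('a, 'b) monoid_scheme \<Rightarrow> bool" where
  "supersolvable G \<longleftrightarrow>
     (\<exists>(k::nat) N. N 0 = carrier G \<and> N (Suc k) = {\<one>\<^bsub>G\<^esub>} \<and>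
        (\<forall>i\<le>Suc k. N i \<lhd> G) \<and>
        (\<forall>i\<le>k. N (Suc i) \<subseteq> N i \<and> cyclic_group ((G\<lparr>carrier := N i\<rparr>) Mod (N (Suc i)))))"

primrec lower_central_series :: "('a, 'b) monoid_scheme \<Rightarrow> nat \<Rightarrow> 'a set" where
  "lower_central_series G 0 = carrier G"
| "lower_central_series G (Suc n) =
     generate G {x \<otimes>\<^bsub>G\<^esub> y \<otimes>\<^bsub>G\<^esub> inv\<^bsub>G\<^esub> x \<otimes>\<^bsub>G\<^esub> inv\<^bsub>G\<^esub> y | x y.
                   x \<in> lower_central_series G n \<and> y \<in> carrier G}"

definition nilpotent_group :: "('a, 'b) monoid_scheme \<Rightarrow> bool" where
  "nilpotent_group G \<longleftrightarrow> (\<exists>n. lower_central_series G n = {\<one>\<^bsub>G\<^esub>})"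

definition fitting_subgroup :: "('a, 'b) monoid_scheme \<Rightarrow> 'a set" where
  "fitting_subgroup G = generate G (\<Union>{N. N \<lhd> G \<and> nilpotent_group (G\<lparr>carrier := N\<rparr>)})"

text \<open>The radical of \<open>K\<close> in the subset \<open>L\<close> of the group \<open>G\<close>.\<close>
definition radical :: "('a, 'b) monoid_scheme \<Rightarrow> 'a set \<Rightarrow> 'a set \<Rightarrow> 'a set" where
  "radical G L K = {g \<in> L. \<exists>n::nat. n \<ge> 1 \<and> g [^]\<^bsub>G\<^esub> n \<in> K}"

definition conj_subgroup :: "('a, 'b) monoid_scheme \<Rightarrow> 'a set \<Rightarrow> 'a \<Rightarrow> 'a set" where
  "conj_subgroup G H g = (\<lambda>h. inv\<^bsub>G\<^esub> g \<otimes>\<^bsub>G\<^esub> h \<otimes>\<^bsub>G\<^esub> g) ` H"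


section \<open>Characters\<close>

definition complex_units :: "complex monoid" where
  "complex_units = \<lparr>carrier = - {0}, mult = (*), one = 1\<rparr>"

text \<open>Only the values of \<open>\<chi>\<close> on \<open>H\<close> matter.\<close>
definition character_on :: "('a, 'b) monoid_scheme \<Rightarrow> 'a set \<Rightarrow> ('a \<Rightarrow> complex) \<Rightarrow> bool" where
  "character_on G H \<chi> \<longleftrightarrow> \<chi> \<in> hom (G\<lparr>carrier := H\<rparr>) complex_units"

text \<open>Meaningful on \<^term>\<open>conj_subgroup G H g\<close> when \<open>\<chi>\<close> is a character of \<open>H\<close>.\<close>
definition conj_character :: "('a, 'b) monoid_scheme \<Rightarrow> ('a \<Rightarrow> complex) \<Rightarrow> 'a \<Rightarrow> 'a \<Rightarrow> complex" where
  "conj_character G \<chi> g x = \<chi> (g \<otimes>\<^bsub>G\<^esub> x \<otimes>\<^bsub>G\<^esub> inv\<^bsub>G\<^esub> g)"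

lemma (in group) conj_character_conj:
  assumes "g \<in> carrier G" "h \<in> carrier G"
  shows "conj_character G \<chi> g (inv g \<otimes> h \<otimes> g) = \<chi> h"
proof -
  have "g \<otimes> (inv g \<otimes> h \<otimes> g) \<otimes> inv g = h"
    using assms by (metis inv_closed m_assoc m_closed r_inv r_one l_one)
  then show ?thesis by (simp add: conj_character_def)
qed


section \<open>Representations\<close>

text \<open>A complex representation of \<open>G\<close> on the subspace \<open>V\<close> of the complex vector space whose
  scalar multiplication is \<open>scale\<close>. Only the values of \<open>\<pi>\<close> for group elements in
  \<^term>\<open>carrier G\<close> and vectors in \<open>V\<close> matter.\<close>

locale group_representation = group G + vector_space scale
  for G (structure) and scale :: "complex \<Rightarrow> 'v::ab_group_add \<Rightarrow> 'v" +
  fixes V :: "'v set" and \<pi> :: "'a \<Rightarrow> 'v \<Rightarrow> 'v"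
  assumes subspace_V: "subspace V"
    and action_closed: "\<lbrakk>g \<in> carrier G; v \<in> V\<rbrakk> \<Longrightarrow> \<pi> g v \<in> V"
    and action_add: "\<lbrakk>g \<in> carrier G; v \<in> V; w \<in> V\<rbrakk> \<Longrightarrow> \<pi> g (v + w) = \<pi> g v + \<pi> g w"
    and action_scale: "\<lbrakk>g \<in> carrier G; v \<in> V\<rbrakk> \<Longrightarrow> \<pi> g (scale c v) = scale c (\<pi> g v)"
    and action_one: "v \<in> V \<Longrightarrow> \<pi> \<one> v = v"
    and action_mult:
      "\<lbrakk>g \<in> carrier G; h \<in> carrier G; v \<in> V\<rbrakk> \<Longrightarrow> \<pi> (g \<otimes> h) v = \<pi> g (\<pi> h v)"

definition fun_scale :: "(complex \<Rightarrow> 'v \<Rightarrow> 'v) \<Rightarrow> complex \<Rightarrow> ('x \<Rightarrow> 'v) \<Rightarrow> 'x \<Rightarrow> 'v" where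
  "fun_scale scale c f = (\<lambda>x. scale c (f x))"

text \<open>The space of \<open>G\<close>-linear endomorphisms of \<open>V\<close>. A map on \<open>V\<close> is represented by its extension
  by zero, so that distinct members are distinct maps on \<open>V\<close>.\<close>
definition rep_End ::
  "('a, 'b) monoid_scheme \<Rightarrow> (complex \<Rightarrow> 'v::ab_group_add \<Rightarrow> 'v) \<Rightarrow> 'v set \<Rightarrow> ('a \<Rightarrow> 'v \<Rightarrow> 'v)
     \<Rightarrow> ('v \<Rightarrow> 'v) set" where
  "rep_End G scale V \<pi> =
     {T. (\<forall>v\<in>V. T v \<in> V) \<and> (\<forall>v. v \<notin> V \<longrightarrow> T v = 0) \<and>
         (\<forall>v\<in>V. \<forall>w\<in>V. T (v + w) = T v + T w) \<and>
         (\<forall>c. \<forall>v\<in>V. T (scale c v) = scale c (T v)) \<and>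
         (\<forall>g\<in>carrier G. \<forall>v\<in>V. T (\<pi> g v) = \<pi> g (T v))}"

text \<open>\<^const>\<open>vector_space.dim\<close> is \<open>0\<close> on infinite-dimensional spaces, so the value \<open>1\<close> means
  honestly one-dimensional.\<close>
definition schur_irreducible ::
  "('a, 'b) monoid_scheme \<Rightarrow> (complex \<Rightarrow> 'v::ab_group_add \<Rightarrow> 'v) \<Rightarrow> 'v set \<Rightarrow> ('a \<Rightarrow> 'v \<Rightarrow> 'v)
     \<Rightarrow> bool" where
  "schur_irreducible G scale V \<pi> \<longleftrightarrow>
     group_representation G scale V \<pi> \<and>
     vector_space.dim (fun_scale scale) (rep_End G scale V \<pi>) = 1"


section \<open>Finite induction\<close>

text \<open>The functions live on the whole type and are required to vanish off \<^term>\<open>carrier G\<close>;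
  \<open>H #> s\<close> is the right coset \<open>Hs\<close>.\<close>
definition ind_space ::
  "('a, 'b) monoid_scheme \<Rightarrow> 'a set \<Rightarrow> 'w::ab_group_add set \<Rightarrow> ('a \<Rightarrow> 'w \<Rightarrow> 'w) \<Rightarrow> ('a \<Rightarrow> 'w) set"
  where
  "ind_space G H W \<rho> =
     {f. (\<forall>x\<in>carrier G. f x \<in> W) \<and> (\<forall>x. x \<notin> carrier G \<longrightarrow> f x = 0) \<and>
         (\<forall>h\<in>H. \<forall>x\<in>carrier G. f (h \<otimes>\<^bsub>G\<^esub> x) = \<rho> h (f x)) \<and>
         (\<exists>S. finite S \<and> S \<subseteq> carrier G \<and> {x. f x \<noteq> 0} \<subseteq> (\<Union>s\<in>S. H #>\<^bsub>G\<^esub> s))}"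

definition ind_action :: "('a, 'b) monoid_scheme \<Rightarrow> 'a \<Rightarrow> ('a \<Rightarrow> 'w::zero) \<Rightarrow> 'a \<Rightarrow> 'w" where
  "ind_action G g f = (\<lambda>x. if x \<in> carrier G then f (x \<otimes>\<^bsub>G\<^esub> g) else 0)"

definition char_action :: "('a \<Rightarrow> complex) \<Rightarrow> 'a \<Rightarrow> complex \<Rightarrow> complex" where
  "char_action \<chi> h z = \<chi> h * z"

lemma ind_spaceI:
  assumes "\<And>x. x \<in> carrier G \<Longrightarrow> f x \<in> W"
    and "\<And>x. x \<notin> carrier G \<Longrightarrow> f x = 0"
    and "\<And>h x. \<lbrakk>h \<in> H; x \<in> carrier G\<rbrakk> \<Longrightarrow> f (h \<otimes>\<^bsub>G\<^esub> x) = \<rho> h (f x)"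
    and "finite S" "S \<subseteq> carrier G" "{x. f x \<noteq> 0} \<subseteq> (\<Union>s\<in>S. H #>\<^bsub>G\<^esub> s)"
  shows "f \<in> ind_space G H W \<rho>"
  unfolding ind_space_def mem_Collect_eq
  by (intro conjI ballI allI impI exI[of _ S] assms)

lemma ind_spaceD:
  assumes "f \<in> ind_space G H W \<rho>"
  shows "x \<in> carrier G \<Longrightarrow> f x \<in> W"
    and "x \<notin> carrier G \<Longrightarrow> f x = 0"
    and "\<lbrakk>h \<in> H; x \<in> carrier G\<rbrakk> \<Longrightarrow> f (h \<otimes>\<^bsub>G\<^esub> x) = \<rho> h (f x)"
    and "\<exists>S. finite S \<and> S \<subseteq> carrier G \<and> {x. f x \<noteq> 0} \<subseteq> (\<Union>s\<in>S. H #>\<^bsub>G\<^esub> s)"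
  using assms unfolding ind_space_def mem_Collect_eq by simp_all

lemma vector_space_fun_scale:
  assumes "vector_space scale"
  shows "vector_space (fun_scale scale)"
proof -
  interpret vector_space scale by fact
  show ?thesis
    by unfold_locales (auto simp: fun_scale_def fun_eq_iff scale_right_distrib scale_left_distrib)
qed

text \<open>The first conjunct of \<^const>\<open>schur_irreducible\<close> is automatic for an induced character:\<close>

lemma (in group) representation_char_action:
  assumes "subgroup H G" "character_on G H \<chi>"
  shows "group_representation (G\<lparr>carrier := H\<rparr>) (*) UNIV (char_action \<chi>)"
proof -
  interpret H: group "G\<lparr>carrier := H\<rparr>"
    using assms(1) by (rule subgroup_imp_group)
  have mult: "\<chi> (g \<otimes> h) = \<chi> g * \<chi> h" if "g \<in> H" "h \<in> H" for g h
    using assms(2) that by (simp add: character_on_def hom_def complex_units_def)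
  have "\<chi> \<one> \<noteq> 0"
    using assms(2) subgroup.one_closed[OF assms(1)]
    by (auto simp: character_on_def hom_def complex_units_def)
  moreover have "\<chi> \<one> * \<chi> \<one> = \<chi> \<one>"
    using mult[of \<one> \<one>] subgroup.one_closed[OF assms(1)] by simp
  ultimately have one: "\<chi> \<one> = 1" by simp
  have vs: "vector_space ((*) :: complex \<Rightarrow> complex \<Rightarrow> complex)"
    by unfold_locales (auto simp: algebra_simps)
  interpret C: vector_space "(*) :: complex \<Rightarrow> complex \<Rightarrow> complex" by (rule vs)
  show ?thesis
  proof unfold_locales
    show "C.subspace UNIV" by (rule C.subspace_UNIV)
  qed (simp_all add: char_action_def one mult distrib_left mult.left_commute)
qed

lemma (in group) representation_ind:
  fixes scale :: "complex \<Rightarrow> 'v::ab_group_add \<Rightarrow> 'v"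
  assumes H: "subgroup H G" and rep: "group_representation (G\<lparr>carrier := H\<rparr>) scale W \<rho>"
  shows "group_representation G (fun_scale scale) (ind_space G H W \<rho>) (ind_action G)"
proof -
  interpret R: group_representation "G\<lparr>carrier := H\<rparr>" scale W \<rho> by fact
  interpret F: vector_space "fun_scale scale"
    by (rule vector_space_fun_scale) unfold_locales
  have Hc: "h \<in> carrier G" if "h \<in> H" for h
    using that subgroup.subset[OF H] by blast
  have W0: "0 \<in> W" and Wadd: "\<And>v w. v \<in> W \<Longrightarrow> w \<in> W \<Longrightarrow> v + w \<in> W"
    and Wsc: "\<And>c v. v \<in> W \<Longrightarrow> scale c v \<in> W"
    using R.subspace_V by (auto simp: R.subspace_def)
  have \<rho>0: "\<rho> h 0 = 0" if "h \<in> H" for h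
    using R.action_add[of h 0 0] that W0 by simp
  let ?I = "ind_space G H W \<rho>"
  have I0: "0 \<in> ?I"
    by (rule ind_spaceI[where S = "{}"]) (auto simp: W0 \<rho>0)
  have Iadd: "f + f' \<in> ?I" if f: "f \<in> ?I" and f': "f' \<in> ?I" for f f'
  proof -
    obtain S where S: "finite S" "S \<subseteq> carrier G" "{x. f x \<noteq> 0} \<subseteq> (\<Union>s\<in>S. H #> s)"
      using ind_spaceD(4)[OF f] by (elim exE conjE) (rule that)
    obtain S' where S': "finite S'" "S' \<subseteq> carrier G" "{x. f' x \<noteq> 0} \<subseteq> (\<Union>s\<in>S'. H #> s)"
      using ind_spaceD(4)[OF f'] by (elim exE conjE) (rule that)
    have "{x. (f + f') x \<noteq> 0} \<subseteq> {x. f x \<noteq> 0} \<union> {x. f' x \<noteq> 0}" by auto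
    also have "\<dots> \<subseteq> (\<Union>s\<in>S \<union> S'. H #> s)"
      unfolding UN_Un by (rule Un_mono[OF S(3) S'(3)])
    finally show ?thesis
      using S(1,2) S'(1,2)
      by (intro ind_spaceI[where S = "S \<union> S'"])
        (simp_all add: ind_spaceD[OF f] ind_spaceD[OF f'] Wadd R.action_add)
  qed
  have Isc: "fun_scale scale c f \<in> ?I" if f: "f \<in> ?I" for c f
  proof -
    obtain S where S: "finite S" "S \<subseteq> carrier G" "{x. f x \<noteq> 0} \<subseteq> (\<Union>s\<in>S. H #> s)"
      using ind_spaceD(4)[OF f] by (elim exE conjE) (rule that)
    have "{x. fun_scale scale c f x \<noteq> 0} \<subseteq> {x. f x \<noteq> 0}" by (auto simp: fun_scale_def)
    then have "{x. fun_scale scale c f x \<noteq> 0} \<subseteq> (\<Union>s\<in>S. H #> s)"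
      using S(3) by (rule subset_trans)
    then show ?thesis
      using S(1,2)
      by (intro ind_spaceI[where S = S])
        (simp_all add: fun_scale_def ind_spaceD[OF f] Wsc R.action_scale)
  qed
  have Iact: "ind_action G g f \<in> ?I" if g: "g \<in> carrier G" and f: "f \<in> ?I" for g f
  proof -
    obtain S where S: "finite S" "S \<subseteq> carrier G" "{x. f x \<noteq> 0} \<subseteq> (\<Union>s\<in>S. H #> s)"
      using ind_spaceD(4)[OF f] by (elim exE conjE) (rule that)
    have "{x. ind_action G g f x \<noteq> 0} \<subseteq> (\<Union>s\<in>(\<lambda>s. s \<otimes> inv g) ` S. H #> s)"
    proof
      fix x assume "x \<in> {x. ind_action G g f x \<noteq> 0}"
      then have x: "x \<in> carrier G" and "f (x \<otimes> g) \<noteq> 0"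
        by (auto simp: ind_action_def split: if_splits)
      then have "x \<otimes> g \<in> (\<Union>s\<in>S. H #> s)" using S(3) by blast
      then obtain s h where sh: "s \<in> S" "h \<in> H" "x \<otimes> g = h \<otimes> s"
        unfolding r_coset_def by blast
      have s: "s \<in> carrier G" using sh(1) S(2) by blast
      have "x = x \<otimes> g \<otimes> inv g" using x g by (simp add: m_assoc)
      also have "\<dots> = h \<otimes> (s \<otimes> inv g)" using sh s g Hc by (simp add: m_assoc)
      finally show "x \<in> (\<Union>s\<in>(\<lambda>s. s \<otimes> inv g) ` S. H #> s)"
        using sh(1,2) unfolding r_coset_def by blast
    qed
    moreover have "finite ((\<lambda>s. s \<otimes> inv g) ` S)" "(\<lambda>s. s \<otimes> inv g) ` S \<subseteq> carrier G"
      using S(1,2) g by auto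
    ultimately show ?thesis
      by (intro ind_spaceI[where S = "(\<lambda>s. s \<otimes> inv g) ` S"])
        (simp_all add: ind_action_def ind_spaceD[OF f] g Hc m_assoc)
  qed
  show ?thesis
  proof unfold_locales
    show "F.subspace ?I" using I0 Iadd Isc by (simp add: F.subspace_def)
  next
    fix v assume "v \<in> ?I"
    then show "ind_action G \<one> v = v"
      by (auto simp: ind_action_def fun_eq_iff ind_spaceD(2))
  next
    show "ind_action G g f \<in> ?I" if "g \<in> carrier G" "f \<in> ?I" for g f
      using that by (rule Iact)
  next
    fix g :: 'a and v w :: "'a \<Rightarrow> 'v"
    show "ind_action G g (v + w) = ind_action G g v + ind_action G g w"
      by (rule ext) (simp add: ind_action_def)
  next
    fix g :: 'a and v :: "'a \<Rightarrow> 'v" and c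
    show "ind_action G g (fun_scale scale c v) = fun_scale scale c (ind_action G g v)"
      by (rule ext) (simp add: ind_action_def fun_scale_def)
  next
    fix g h and v :: "'a \<Rightarrow> 'v"
    assume "g \<in> carrier G" "h \<in> carrier G"
    then show "ind_action G (g \<otimes> h) v = ind_action G g (ind_action G h v)"
      by (intro ext) (simp add: ind_action_def m_assoc)
  qed
qed

end

theory Submission
  imports Defs
begin

text \<open>Why the theorem holds. Let \<open>\<delta>\<close> be the element of \<open>Ind(\<chi>)\<close> that equals \<open>\<chi>\<close> on \<open>H\<close> and \<open>0\<close>
  elsewhere. Its translates span the induced representation, so a \<open>G\<close>-endomorphism \<open>T\<close> is determined
  by \<open>\<phi> = T \<delta>\<close>, and \<open>T\<close> is scalar as soon as \<open>\<phi>\<close> is supported on \<open>H\<close>. Since \<open>H\<close> acts on \<open>\<delta>\<close> by \<open>\<chi>\<close>,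
  it acts on \<open>\<phi>\<close> by \<open>\<chi>\<close> as well. Suppose \<open>\<phi> g \<noteq> 0\<close>.

  On the one hand, computing \<open>\<phi> (g x)\<close> in two ways for \<open>x \<in> H\<^sup>g \<inter> H\<close>, where \<open>H\<^sup>g = g\<^sup>-\<^sup>1 H g\<close>, gives
  \<open>\<chi>\<^sup>g = \<chi>\<close> on that intersection (\<open>conj_character_eq_of_eigenvector\<close>).
  On the other hand, \<open>\<phi>\<close> is nonzero on all of \<open>g H\<close>, which is therefore covered by finitely many
  right cosets of \<open>H\<close>; by the pigeonhole principle every element of \<open>H\<close> has a positive power in \<open>H\<^sup>g\<close>
  (\<open>eigenvector_support_commensurates\<close>).

  Supersolvability makes the last relation symmetric (\<open>conj_subgroup_subset_radical\<close>). This is a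
  Hirsch length argument: each factor \<open>N\<^sub>i/N\<^sub>i\<^sub>+\<^sub>1\<close> of the given series is cyclic, so a subgroup \<open>A\<close> of \<open>B\<close> has
  finite index in \<open>B\<close> as soon as every factor in which the image of \<open>B\<close> is infinite is also one in
  which the image of \<open>A\<close> is infinite (\<open>finite_coset_cover\<close>). For \<open>A = H \<inter> H\<^sup>g\<close> and \<open>B = H\<^sup>g\<close> this
  holds, because the \<open>N\<^sub>i\<close> are normal: \<open>H\<^sup>g\<close> has infinite image in the same factors as \<open>H\<close>, and \<open>H\<close>
  in the same factors as \<open>A\<close>. Hence every element of \<open>H\<^sup>g\<close> has a positive power in \<open>H\<close>.

  So \<open>H\<close> and \<open>H\<^sup>g\<close> have the same radical, and intersecting with the Fitting subgroup \<open>F\<close>, which is normal, shows that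
  \<open>g\<close> normalizes the radical of \<open>H \<inter> F\<close> in \<open>F\<close> (\<open>mem_normalizer_radical_fitting\<close>). The hypothesis on
  \<open>\<chi>\<close> now forces \<open>g \<in> H\<close>.\<close>

section \<open>Conjugate subgroups and the Fitting subgroup\<close>

lemma (in group) conj_nat_pow:
  assumes "g \<in> carrier G" "x \<in> carrier G"
  shows "(g \<otimes> x \<otimes> inv g) [^] (n::nat) = g \<otimes> x [^] n \<otimes> inv g"
proof (induction n)
  case (Suc n)
  have "(g \<otimes> x [^] n \<otimes> inv g) \<otimes> (g \<otimes> x \<otimes> inv g) = g \<otimes> x [^] n \<otimes> (inv g \<otimes> g) \<otimes> x \<otimes> inv g"
    using assms by (simp only: m_assoc m_closed inv_closed nat_pow_closed)
  with Suc show ?case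
    using assms by (simp add: m_assoc)
qed (use assms in simp)

lemma (in group) mem_conj_subgroup_iff:
  assumes "H \<subseteq> carrier G" "g \<in> carrier G" "x \<in> carrier G"
  shows "x \<in> conj_subgroup G H g \<longleftrightarrow> g \<otimes> x \<otimes> inv g \<in> H"
proof
  assume "x \<in> conj_subgroup G H g"
  then obtain h where h: "h \<in> H" "x = inv g \<otimes> h \<otimes> g"
    by (auto simp: conj_subgroup_def)
  have "h \<in> carrier G"
    using h(1) assms(1) by blast
  then have "g \<otimes> x \<otimes> inv g = h"
    using assms(2) h(2) by (metis inv_closed inv_solve_right m_assoc m_closed r_inv l_one)
  with h show "g \<otimes> x \<otimes> inv g \<in> H" by simp
next
  assume *: "g \<otimes> x \<otimes> inv g \<in> H"
  have "inv g \<otimes> (g \<otimes> x \<otimes> inv g) \<otimes> g = x"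
    using assms(2,3) by (metis inv_closed inv_inv inv_solve_right m_assoc m_closed l_inv l_one)
  with * show "x \<in> conj_subgroup G H g"
    unfolding conj_subgroup_def by (metis imageI)
qed

lemma (in group) conj_subgroup_subset:
  assumes "H \<subseteq> carrier G" "g \<in> carrier G"
  shows "conj_subgroup G H g \<subseteq> carrier G"
  using assms by (auto simp: conj_subgroup_def)

lemma (in group) subgroup_conj_subgroup:
  assumes H: "subgroup H G" and g: "g \<in> carrier G"
  shows "subgroup (conj_subgroup G H g) G"
proof -
  interpret H: subgroup H G by fact
  have mem: "x \<in> conj_subgroup G H g \<longleftrightarrow> g \<otimes> x \<otimes> inv g \<in> H" if "x \<in> carrier G" for x
    using mem_conj_subgroup_iff[OF H.subset g that] .
  have sub: "conj_subgroup G H g \<subseteq> carrier G"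
    using conj_subgroup_subset[OF H.subset g] .
  show ?thesis
  proof (rule subgroupI)
    show "conj_subgroup G H g \<noteq> {}"
      using H.one_closed unfolding conj_subgroup_def by blast
  next
    fix x assume x: "x \<in> conj_subgroup G H g"
    then have xc: "x \<in> carrier G" using sub by blast
    have "inv (g \<otimes> x \<otimes> inv g) = g \<otimes> inv x \<otimes> inv g"
      using xc g by (simp add: inv_mult_group m_assoc)
    then show "inv x \<in> conj_subgroup G H g"
      using x xc by (metis mem H.m_inv_closed inv_closed)
  next
    fix x y assume xy: "x \<in> conj_subgroup G H g" "y \<in> conj_subgroup G H g"
    then have c: "x \<in> carrier G" "y \<in> carrier G" using sub by auto
    have "(g \<otimes> x \<otimes> inv g) \<otimes> (g \<otimes> y \<otimes> inv g) = g \<otimes> x \<otimes> (inv g \<otimes> g) \<otimes> y \<otimes> inv g"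
      using c g by (simp only: m_assoc m_closed inv_closed)
    also have "\<dots> = g \<otimes> (x \<otimes> y) \<otimes> inv g"
      using c g by (simp add: m_assoc)
    finally show "x \<otimes> y \<in> conj_subgroup G H g"
      using xy c by (metis mem H.m_closed m_closed)
  qed (rule sub)
qed

lemma (in group) fitting_subgroup_normal: "fitting_subgroup G \<lhd> G"
  unfolding fitting_subgroup_def
proof (rule normal_generateI)
  show "\<Union>{N. N \<lhd> G \<and> nilpotent_group (G\<lparr>carrier := N\<rparr>)} \<subseteq> carrier G"
    using normal_imp_subgroup subgroup.subset by blast
next
  fix h g
  assume "h \<in> \<Union>{N. N \<lhd> G \<and> nilpotent_group (G\<lparr>carrier := N\<rparr>)}" and g: "g \<in> carrier G"
  then obtain N where N: "N \<lhd> G" "nilpotent_group (G\<lparr>carrier := N\<rparr>)" "h \<in> N"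
    by blast
  from normal.inv_op_closed2[OF N(1) g N(3)] N(1,2)
  show "g \<otimes> h \<otimes> inv g \<in> \<Union>{N. N \<lhd> G \<and> nilpotent_group (G\<lparr>carrier := N\<rparr>)}"
    by blast
qed

section \<open>Finite coset covers in supersolvable groups\<close>

text \<open>The inductive step along the series, for a homomorphism \<open>\<phi>\<close> with kernel \<open>N\<close> that maps \<open>B\<close> into
  a cyclic group. That \<open>A\<close> has finite index in \<open>B\<close> is expressed by covering \<open>B\<close> with finitely many
  right cosets \<open>A c\<close>. The inclusion \<open>A \<subseteq> radical G (carrier G) N\<close> says that \<open>\<phi> ` A\<close> is a torsion
  group, so the hypothesis \<open>tors\<close> excludes that \<open>\<phi> ` B\<close> is infinite while \<open>\<phi> ` A\<close> is finite.\<close>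

lemma (in group) finite_coset_cover_extension:
  fixes A B Q \<phi>
  defines "N \<equiv> kernel G Q \<phi>"
  assumes \<phi>: "group_hom G Q \<phi>"
    and A: "subgroup A G" and B: "subgroup B G" and AB: "A \<subseteq> B"
    and X: "X \<in> carrier Q" and cyc: "\<phi> ` B \<subseteq> range (\<lambda>j::int. X [^]\<^bsub>Q\<^esub> j)"
    and tors: "A \<subseteq> radical G (carrier G) N \<Longrightarrow> B \<subseteq> radical G (carrier G) N"
    and C: "finite C" "C \<subseteq> carrier G" "B \<inter> N \<subseteq> A <#> C"
  shows "\<exists>C'. finite C' \<and> C' \<subseteq> carrier G \<and> B \<subseteq> A <#> C'"
proof (cases "B \<subseteq> N")
  case True
  then have "B \<inter> N = B" by blast
  with C show ?thesis by auto
next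
  case False
  interpret \<phi>: group_hom G Q \<phi> by fact
  have Ac: "a \<in> carrier G" if "a \<in> A" for a
    using that subgroup.subset[OF A] by blast
  have Bc: "b \<in> carrier G" if "b \<in> B" for b
    using that subgroup.subset[OF B] by blast
  have N: "x \<in> N \<longleftrightarrow> x \<in> carrier G \<and> \<phi> x = \<one>\<^bsub>Q\<^esub>" for x
    by (auto simp: N_def kernel_def)
  \<comment> \<open>If \<open>\<phi> ` A\<close> is torsion, then so is \<open>\<phi> ` B\<close>; it is nontrivial and contained in the powers of \<open>X\<close>,
    so \<open>X\<close> has finite order and \<open>a = \<one>\<close> works. Otherwise a non-torsion element of \<open>A\<close> or its
    inverse works.\<close>
  have "\<exists>a\<in>A. \<exists>m>0. \<phi> a = X [^]\<^bsub>Q\<^esub> (m::int)"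
  proof (cases "A \<subseteq> radical G (carrier G) N")
    case True
    obtain b where b: "b \<in> B" "\<phi> b \<noteq> \<one>\<^bsub>Q\<^esub>"
      using False Bc unfolding subset_iff N by blast
    obtain j :: int where j: "\<phi> b = X [^]\<^bsub>Q\<^esub> j"
      using cyc b(1) by blast
    obtain n :: nat where n: "n \<ge> 1" "b [^] n \<in> N"
      using tors[OF True] b(1) by (auto simp: radical_def)
    have "X [^]\<^bsub>Q\<^esub> (j * int n) = (X [^]\<^bsub>Q\<^esub> j) [^]\<^bsub>Q\<^esub> n"
      using X by (simp add: \<phi>.H.int_pow_pow flip: int_pow_int)
    also have "\<dots> = \<one>\<^bsub>Q\<^esub>"
      using n(2) Bc[OF b(1)] by (simp add: N \<phi>.hom_nat_pow j)
    finally have 1: "X [^]\<^bsub>Q\<^esub> (j * int n) = \<one>\<^bsub>Q\<^esub>" .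
    then have 2: "X [^]\<^bsub>Q\<^esub> \<bar>j * int n\<bar> = \<one>\<^bsub>Q\<^esub>"
      using X by (auto simp: abs_if \<phi>.H.int_pow_neg)
    have "j \<noteq> 0"
      using b(2) j by auto
    with n(1) have "\<bar>j * int n\<bar> > 0" by simp
    with 2 subgroup.one_closed[OF A] show ?thesis
      by (metis \<phi>.hom_one)
  next
    case False
    then obtain a where a: "a \<in> A" "\<And>n::nat. n \<ge> 1 \<Longrightarrow> a [^] n \<notin> N"
      using Ac by (auto simp: radical_def)
    obtain j :: int where j: "\<phi> a = X [^]\<^bsub>Q\<^esub> j"
      using cyc a(1) AB by blast
    have "j \<noteq> 0"
      using a(2)[of 1] Ac[OF a(1)] j by (auto simp: N)
    then consider "j > 0" | "- j > 0" by linarith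
    then show ?thesis
    proof cases
      case 1
      with a(1) j show ?thesis by blast
    next
      case 2
      have "\<phi> (inv a) = X [^]\<^bsub>Q\<^esub> (- j)"
        using Ac[OF a(1)] X j by (simp add: \<phi>.H.int_pow_neg)
      with 2 subgroup.m_inv_closed[OF A a(1)] show ?thesis by blast
    qed
  qed
  then obtain a and m :: int where a: "a \<in> A" and m: "m > 0" "\<phi> a = X [^]\<^bsub>Q\<^esub> m"
    by blast
  \<comment> \<open>Modulo \<open>A\<close>, an element of \<open>B\<close> with image \<open>X\<^sup>j\<close> can be moved to one with image \<open>X\<^sup>r\<close>, \<open>0 \<le> r < m\<close>;
    the elements \<open>d r\<close> represent the residues that occur.\<close>
  define I where "I = {r \<in> {0..<m}. \<exists>d\<in>B. \<phi> d = X [^]\<^bsub>Q\<^esub> r}"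
  have "\<forall>r\<in>I. \<exists>d. d \<in> B \<and> \<phi> d = X [^]\<^bsub>Q\<^esub> r"
    by (auto simp: I_def)
  then obtain d where d: "\<And>r. r \<in> I \<Longrightarrow> d r \<in> B" "\<And>r. r \<in> I \<Longrightarrow> \<phi> (d r) = X [^]\<^bsub>Q\<^esub> r"
    by metis
  define C' where "C' = (\<lambda>(c, r). c \<otimes> d r) ` (C \<times> I)"
  have "b \<in> A <#> C'" if b: "b \<in> B" for b
  proof -
    obtain j :: int where j: "\<phi> b = X [^]\<^bsub>Q\<^esub> j"
      using cyc b by blast
    define r where "r = j mod m"
    define p where "p = a [^] (j div m)"
    define e where "e = inv p \<otimes> b"
    have p: "p \<in> A"
      unfolding p_def using subgroup_int_pow_closed[OF A a] .
    have e: "e \<in> B"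
      unfolding e_def using p AB b B by (meson subgroup.m_closed subgroup.m_inv_closed subsetD)
    have "\<phi> p = X [^]\<^bsub>Q\<^esub> (m * (j div m))"
      unfolding p_def using Ac[OF a] X by (simp add: \<phi>.hom_int_pow m(2) \<phi>.H.int_pow_pow)
    then have "\<phi> e = inv\<^bsub>Q\<^esub> (X [^]\<^bsub>Q\<^esub> (m * (j div m))) \<otimes>\<^bsub>Q\<^esub> X [^]\<^bsub>Q\<^esub> j"
      unfolding e_def using Ac[OF p] Bc[OF b] j by simp
    also have "\<dots> = X [^]\<^bsub>Q\<^esub> (- (m * (j div m)) + j)"
      by (simp only: \<phi>.H.int_pow_neg[OF X] \<phi>.H.int_pow_mult[OF X])
    also have "- (m * (j div m)) + j = r"
      by (simp add: r_def minus_mult_div_eq_mod)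
    finally have er: "\<phi> e = X [^]\<^bsub>Q\<^esub> r" .
    have r: "r \<in> I"
      using er e m(1) by (auto simp: I_def r_def)
    have "e \<otimes> inv (d r) \<in> B"
      using e d(1)[OF r] B by (simp add: subgroup.m_closed subgroup.m_inv_closed)
    moreover have "e \<otimes> inv (d r) \<in> N"
      using Bc[OF e] Bc[OF d(1)[OF r]] X by (simp add: N er d(2)[OF r])
    ultimately have "e \<otimes> inv (d r) \<in> A <#> C"
      using C(3) by blast
    then obtain a' c where ac: "a' \<in> A" "c \<in> C" "e \<otimes> inv (d r) = a' \<otimes> c"
      by (auto simp: set_mult_def)
    have cc: "c \<in> carrier G" using ac(2) C(2) by blast
    have "e = a' \<otimes> c \<otimes> d r"
      using ac(3) Bc[OF e] Bc[OF d(1)[OF r]] Ac[OF ac(1)] cc by (metis inv_solve_right' m_closed inv_closed inv_inv)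
    moreover have "b = p \<otimes> e"
      unfolding e_def using Ac[OF p] Bc[OF b] by (simp flip: m_assoc)
    ultimately have "b = (p \<otimes> a') \<otimes> (c \<otimes> d r)"
      using Ac[OF p] Ac[OF ac(1)] cc Bc[OF d(1)[OF r]] by (simp add: m_assoc)
    moreover have "p \<otimes> a' \<in> A"
      using p ac(1) A by (simp add: subgroup.m_closed)
    moreover have "c \<otimes> d r \<in> C'"
      using ac(2) r by (auto simp: C'_def)
    ultimately show ?thesis
      unfolding set_mult_def by blast
  qed
  moreover have "finite C'"
  proof -
    have "finite I"
      by (rule finite_subset[of _ "{0..<m}"]) (auto simp: I_def)
    with C(1) show ?thesis by (simp add: C'_def)
  qed
  moreover have "C' \<subseteq> carrier G"
    using C(2) d(1) Bc by (auto simp: C'_def)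
  ultimately show ?thesis by blast
qed

text \<open>Pigeonhole principle: two powers of \<open>b \<in> B\<close> lie in the same right coset of \<open>A\<close>.\<close>

lemma (in group) subset_radical_of_finite_coset_cover:
  assumes A: "subgroup A G" and B: "subgroup B G" and C: "finite C" "C \<subseteq> carrier G" "B \<subseteq> A <#> C"
  shows "B \<subseteq> radical G (carrier G) A"
proof
  fix b assume b: "b \<in> B"
  have bc: "b \<in> carrier G" using b subgroup.subset[OF B] by blast
  have "\<exists>c\<in>C. b [^] (n::nat) \<otimes> inv c \<in> A" for n
  proof -
    have "b [^] n \<in> A <#> C"
      using subgroup_int_pow_closed[OF B b, of "int n"] C(3) by (auto simp: int_pow_int)
    then obtain a c where ac: "a \<in> A" "c \<in> C" "b [^] n = a \<otimes> c"
      by (auto simp: set_mult_def)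
    moreover have "a \<in> carrier G" "c \<in> carrier G"
      using ac C(2) subgroup.subset[OF A] by auto
    ultimately have "b [^] n \<otimes> inv c = a" by (simp add: m_assoc)
    with ac(1,2) show ?thesis by metis
  qed
  then obtain c where c: "\<And>n::nat. c n \<in> C" "\<And>n::nat. b [^] n \<otimes> inv (c n) \<in> A"
    by metis
  have "\<not> inj c"
    using c(1) C(1) by (metis finite_subset image_subsetI infinite_UNIV_nat range_inj_infinite)
  then obtain i j where ij: "i < j" "c i = c j"
    unfolding inj_def by (metis linorder_less_linear)
  have cc: "c j \<in> carrier G" using c(1) C(2) by blast
  have "(b [^] j \<otimes> inv (c j)) \<otimes> inv (b [^] i \<otimes> inv (c j)) \<in> A"
    using c(2)[of i] c(2)[of j] ij(2) A by (simp add: subgroup.m_closed subgroup.m_inv_closed)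
  also have "(b [^] j \<otimes> inv (c j)) \<otimes> inv (b [^] i \<otimes> inv (c j)) = b [^] j \<otimes> inv (b [^] i)"
    using bc cc by (simp add: inv_mult_group m_assoc) (simp flip: m_assoc)
  also have "b [^] j = b [^] (j - i) \<otimes> b [^] i"
    using ij(1) bc by (simp add: nat_pow_mult)
  also have "b [^] (j - i) \<otimes> b [^] i \<otimes> inv (b [^] i) = b [^] (j - i)"
    using bc by (simp add: m_assoc)
  finally show "b \<in> radical G (carrier G) A"
    using ij(1) bc by (auto simp: radical_def intro!: exI[of _ "j - i"])
qed

text \<open>A generator of \<open>N / M\<close>, with its powers taken in the larger quotient \<open>G / M\<close>: there the
  projection is defined on all of \<open>G\<close>.\<close>

lemma (in group) cyclic_factor_generator:
  assumes M: "M \<lhd> G" and N: "N \<lhd> G" and MN: "M \<subseteq> N"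
    and cyc: "cyclic_group ((G\<lparr>carrier := N\<rparr>) Mod M)"
  obtains X where "X \<in> carrier (G Mod M)"
    "(#>) M ` N \<subseteq> range (\<lambda>j::int. X [^]\<^bsub>G Mod M\<^esub> j)"
proof -
  let ?N = "G\<lparr>carrier := N\<rparr>"
  have Ns: "subgroup N G" and Ms: "subgroup M G"
    using M N by (auto intro: normal_imp_subgroup)
  have MN': "M \<lhd> ?N"
    using normal_restrict_supergroup[OF Ns M MN] .
  interpret N: group ?N
    using Ns by (rule subgroup_imp_group)
  interpret Q: group "?N Mod M"
    using MN' by (rule normal.factorgroup_is_group)
  interpret h: group_hom ?N "?N Mod M" "(#>\<^bsub>?N\<^esub>) M"
    using normal.r_coset_hom_Mod[OF MN'] by unfold_locales
  interpret g: group_hom G "G Mod M" "(#>) M"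
    using normal.r_coset_hom_Mod[OF M] normal.factorgroup_is_group[OF M]
    by (simp add: group_hom_def group_hom_axioms_def is_group)
  have coset: "M #>\<^bsub>?N\<^esub> y = M #> y" for y
    by (simp add: r_coset_def)
  obtain Y where Y: "Y \<in> carrier (?N Mod M)" "carrier (?N Mod M) = range (\<lambda>j::int. Y [^]\<^bsub>?N Mod M\<^esub> j)"
    using cyc unfolding Q.cyclic_group by blast
  obtain x where x: "x \<in> N" "Y = M #>\<^bsub>?N\<^esub> x"
    using Y(1) by (auto simp: FactGroup_def RCOSETS_def)
  have xc: "x \<in> carrier G" using x(1) subgroup.subset[OF Ns] by blast
  have "M #> y \<in> range (\<lambda>j::int. (M #> x) [^]\<^bsub>G Mod M\<^esub> j)" if y: "y \<in> N" for y
  proof -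
    have "M #>\<^bsub>?N\<^esub> y \<in> carrier (?N Mod M)"
      using h.hom_closed[of y] y by simp
    then obtain j :: int where "M #>\<^bsub>?N\<^esub> y = Y [^]\<^bsub>?N Mod M\<^esub> j"
      using Y(2) by blast
    also have "\<dots> = M #>\<^bsub>?N\<^esub> (x [^]\<^bsub>?N\<^esub> j)"
      using h.hom_int_pow[of x j] x by simp
    also have "x [^]\<^bsub>?N\<^esub> j = x [^] j"
      using int_pow_consistent[OF Ns x(1)] by simp
    also have "M #>\<^bsub>?N\<^esub> (x [^] j) = (M #> x) [^]\<^bsub>G Mod M\<^esub> j"
      using g.hom_int_pow[OF xc] by (simp add: coset)
    finally show ?thesis by (auto simp: coset)
  qed
  moreover have "M #> x \<in> carrier (G Mod M)"
    using g.hom_closed[OF xc] .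
  ultimately show ?thesis using that by blast
qed

lemma (in group) kernel_r_coset:
  assumes "M \<lhd> G"
  shows "kernel G (G Mod M) ((#>) M) = M"
proof -
  have "subgroup M G" using assms by (rule normal_imp_subgroup)
  then show ?thesis
    using coset_join1[of M] coset_join2[of _ M] subgroup.subset[of M G]
    by (auto simp: kernel_def)
qed

text \<open>The hypothesis \<open>tors\<close> compares Hirsch lengths factor by factor: wherever the image of \<open>B\<close> in
  \<open>N i / N (Suc i)\<close> is infinite, so is that of \<open>A\<close>.\<close>

lemma (in group) finite_coset_cover:
  assumes N: "N 0 = carrier G" "N (Suc k) = {\<one>}" "\<And>i. i \<le> Suc k \<Longrightarrow> N i \<lhd> G"
      "\<And>i. i \<le> k \<Longrightarrow> N (Suc i) \<subseteq> N i"
      "\<And>i. i \<le> k \<Longrightarrow> cyclic_group ((G\<lparr>carrier := N i\<rparr>) Mod (N (Suc i)))"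
    and A: "subgroup A G" and B: "subgroup B G" and AB: "A \<subseteq> B"
    and tors: "\<And>i. i \<le> k \<Longrightarrow> A \<inter> N i \<subseteq> radical G (carrier G) (N (Suc i)) \<Longrightarrow>
                 B \<inter> N i \<subseteq> radical G (carrier G) (N (Suc i))"
  shows "\<exists>C. finite C \<and> C \<subseteq> carrier G \<and> B \<subseteq> A <#> C"
proof -
  have "\<exists>C. finite C \<and> C \<subseteq> carrier G \<and> B \<inter> N i \<subseteq> (A \<inter> N i) <#> C" if "i \<le> Suc k" for i
    using that
  proof (induction rule: inc_induct)
    case base
    have "B \<inter> N (Suc k) \<subseteq> (A \<inter> N (Suc k)) <#> {\<one>}"
      using subgroup.one_closed[OF A] by (auto simp: N(2) set_mult_def)
    then show ?case
      by (intro exI[of _ "{\<one>}"]) simp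
  next
    case (step i)
    then have i: "i \<le> k" by simp
    have Ni: "N i \<lhd> G" "N (Suc i) \<lhd> G"
      using N(3) i by simp_all
    obtain C where C: "finite C" "C \<subseteq> carrier G" "B \<inter> N (Suc i) \<subseteq> (A \<inter> N (Suc i)) <#> C"
      using step.IH by blast
    obtain X where X: "X \<in> carrier (G Mod N (Suc i))"
      "(#>) (N (Suc i)) ` N i \<subseteq> range (\<lambda>j::int. X [^]\<^bsub>G Mod N (Suc i)\<^esub> j)"
      using cyclic_factor_generator[OF Ni(2,1) N(4,5)[OF i]] .
    have hom: "group_hom G (G Mod N (Suc i)) ((#>) (N (Suc i)))"
      using normal.r_coset_hom_Mod[OF Ni(2)] normal.factorgroup_is_group[OF Ni(2)]
      by (simp add: group_hom_def group_hom_axioms_def is_group)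
    note ext = finite_coset_cover_extension[OF hom, unfolded kernel_r_coset[OF Ni(2)]]
    show ?case
    proof (rule ext[OF _ _ _ X(1)])
      show "subgroup (A \<inter> N i) G" "subgroup (B \<inter> N i) G"
        using A B Ni(1) by (simp_all add: normal_imp_subgroup subgroups_Inter_pair)
      show "A \<inter> N i \<subseteq> B \<inter> N i" using AB by blast
      show "(#>) (N (Suc i)) ` (B \<inter> N i) \<subseteq> range (\<lambda>j::int. X [^]\<^bsub>G Mod N (Suc i)\<^esub> j)"
        using X(2) by blast
      show "B \<inter> N i \<inter> N (Suc i) \<subseteq> (A \<inter> N i) <#> C"
        using C(3) N(4)[OF i] unfolding set_mult_def by blast
    qed (use C tors[OF i] in simp_all)
  qed
  from this[of 0] show ?thesis
    using subgroup.subset[OF A] subgroup.subset[OF B] by (simp add: N(1) Int_absorb2)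
qed

text \<open>In a supersolvable group, commensuration of \<open>H\<close> into its conjugate is automatically symmetric:
  the covering criterion applies to \<open>H \<inter> H\<^sup>g\<close> inside \<open>H\<^sup>g\<close>.\<close>

lemma (in group) conj_subgroup_subset_radical:
  assumes G: "supersolvable G" and H: "subgroup H G" and g: "g \<in> carrier G"
    and sub: "H \<subseteq> radical G (carrier G) (conj_subgroup G H g)"
  shows "conj_subgroup G H g \<subseteq> radical G (carrier G) H"
proof -
  let ?B = "conj_subgroup G H g"
  obtain k :: nat and N where N: "N 0 = carrier G" "N (Suc k) = {\<one>}" "\<And>i. i \<le> Suc k \<Longrightarrow> N i \<lhd> G"
      "\<And>i. i \<le> k \<Longrightarrow> N (Suc i) \<subseteq> N i"
      "\<And>i. i \<le> k \<Longrightarrow> cyclic_group ((G\<lparr>carrier := N i\<rparr>) Mod (N (Suc i)))"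
    using G unfolding supersolvable_def by metis
  have B: "subgroup ?B G"
    using H g by (rule subgroup_conj_subgroup)
  have A: "subgroup (H \<inter> ?B) G"
    using H B by (rule subgroups_Inter_pair)
  have Hc: "H \<subseteq> carrier G" using H by (rule subgroup.subset)
  \<comment> \<open>For \<open>b \<in> ?B \<inter> N i\<close>, conjugate \<open>b\<close> into \<open>H\<close>, pass to a power lying in \<open>H \<inter> ?B\<close>, use the
    hypothesis there, and conjugate back.\<close>
  have tors: "?B \<inter> N i \<subseteq> radical G (carrier G) (N (Suc i))"
    if i: "i \<le> k" and *: "H \<inter> ?B \<inter> N i \<subseteq> radical G (carrier G) (N (Suc i))" for i
  proof
    have Ni: "N i \<lhd> G" "N (Suc i) \<lhd> G"
      using N(3) i by simp_all
    fix b assume b: "b \<in> ?B \<inter> N i"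
    then have bc: "b \<in> carrier G" using subgroup.subset[OF B] by blast
    define h where "h = g \<otimes> b \<otimes> inv g"
    have h: "h \<in> H" "h \<in> N i" "h \<in> carrier G"
      using b g bc mem_conj_subgroup_iff[OF Hc g bc] normal.inv_op_closed2[OF Ni(1) g]
      by (auto simp: h_def)
    obtain n :: nat where n: "n \<ge> 1" "h [^] n \<in> ?B"
      using sub h(1) by (auto simp: radical_def)
    have "h [^] n \<in> H \<inter> ?B \<inter> N i"
      using n(2) subgroup_int_pow_closed[OF H h(1), of "int n"]
        subgroup_int_pow_closed[OF normal_imp_subgroup[OF Ni(1)] h(2), of "int n"]
      by (simp add: int_pow_int)
    then obtain m :: nat where m: "m \<ge> 1" "(h [^] n) [^] m \<in> N (Suc i)"
      using * by (auto simp: radical_def)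
    have "g \<otimes> b [^] (n * m) \<otimes> inv g \<in> N (Suc i)"
      using m(2) g bc h(3) by (simp add: nat_pow_pow) (simp add: h_def conj_nat_pow)
    then have "inv g \<otimes> (g \<otimes> b [^] (n * m) \<otimes> inv g) \<otimes> g \<in> N (Suc i)"
      using normal.inv_op_closed1[OF Ni(2) g] by blast
    also have "inv g \<otimes> (g \<otimes> b [^] (n * m) \<otimes> inv g) \<otimes> g = b [^] (n * m)"
      using g bc by (simp add: m_assoc) (simp flip: m_assoc)
    finally show "b \<in> radical G (carrier G) (N (Suc i))"
      using bc n(1) m(1) by (auto simp: radical_def intro!: exI[of _ "n * m"])
  qed
  obtain C where "finite C" "C \<subseteq> carrier G" "?B \<subseteq> (H \<inter> ?B) <#> C"
    using finite_coset_cover[of N k "H \<inter> ?B" ?B, OF N A B _ tors] by blast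
  then have "?B \<subseteq> radical G (carrier G) (H \<inter> ?B)"
    by (rule subset_radical_of_finite_coset_cover[OF A B])
  then show ?thesis
    by (auto simp: radical_def)
qed

section \<open>Elements that commensurate H normalize the radical\<close>

lemma (in group) mem_normalizer_radical_fitting:
  assumes G: "supersolvable G" and H: "subgroup H G" and g: "g \<in> carrier G"
    and sub: "H \<subseteq> radical G (carrier G) (conj_subgroup G H g)"
  shows "g \<in> normalizer G (radical G (fitting_subgroup G) (H \<inter> fitting_subgroup G))"
proof -
  let ?F = "fitting_subgroup G" and ?B = "conj_subgroup G H g"
  let ?R = "radical G ?F (H \<inter> ?F)"
  have F: "?F \<lhd> G" by (rule fitting_subgroup_normal)
  have Fs: "subgroup ?F G" using F by (rule normal_imp_subgroup)
  have Hc: "H \<subseteq> carrier G" using H by (rule subgroup.subset)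
  have B: "subgroup ?B G"
    using H g by (rule subgroup_conj_subgroup)
  have sub': "?B \<subseteq> radical G (carrier G) H"
    using assms by (rule conj_subgroup_subset_radical)
  \<comment> \<open>Powers of \<open>x \<in> ?F\<close> stay in \<open>?F\<close>, so only membership in \<open>H\<close> matters.\<close>
  have R: "x \<in> ?R \<longleftrightarrow> x \<in> ?F \<and> (\<exists>n::nat. n \<ge> 1 \<and> x [^] n \<in> H)" for x
    using subgroup_int_pow_closed[OF Fs, of x "int n" for n]
    by (auto simp: radical_def int_pow_int)
  have Rc: "?R \<subseteq> carrier G"
    using subgroup.subset[OF Fs] by (auto simp: radical_def)
  have conj: "g \<otimes> x \<otimes> inv g \<in> ?R \<longleftrightarrow> x \<in> ?R" if x: "x \<in> ?F" for x
  proof -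
    have xc: "x \<in> carrier G" using x subgroup.subset[OF Fs] by blast
    have "g \<otimes> x \<otimes> inv g \<in> ?F"
      using normal.inv_op_closed2[OF F g x] .
    then have "g \<otimes> x \<otimes> inv g \<in> ?R \<longleftrightarrow> (\<exists>n::nat. n \<ge> 1 \<and> x [^] n \<in> ?B)"
      using g xc by (simp add: R conj_nat_pow mem_conj_subgroup_iff[OF Hc g])
    also have "\<dots> \<longleftrightarrow> (\<exists>n::nat. n \<ge> 1 \<and> x [^] n \<in> H)"
    proof safe
      fix n :: nat assume n: "n \<ge> 1" "x [^] n \<in> ?B"
      then obtain m :: nat where "m \<ge> 1" "(x [^] n) [^] m \<in> H"
        using sub' by (auto simp: radical_def)
      with n(1) xc show "\<exists>n::nat. n \<ge> 1 \<and> x [^] n \<in> H"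
        by (intro exI[of _ "n * m"]) (simp add: nat_pow_pow)
    next
      fix n :: nat assume n: "n \<ge> 1" "x [^] n \<in> H"
      then obtain m :: nat where "m \<ge> 1" "(x [^] n) [^] m \<in> ?B"
        using sub by (auto simp: radical_def)
      with n(1) xc show "\<exists>n::nat. n \<ge> 1 \<and> x [^] n \<in> ?B"
        by (intro exI[of _ "n * m"]) (simp add: nat_pow_pow)
    qed
    finally show ?thesis using x by (simp add: R)
  qed
  have "g <# ?R #> inv g = ?R"
  proof
    show "g <# ?R #> inv g \<subseteq> ?R"
      using conj R by (auto simp: r_coset_def l_coset_def)
    show "?R \<subseteq> g <# ?R #> inv g"
    proof
      fix y assume y: "y \<in> ?R"
      then have yF: "y \<in> ?F" and yc: "y \<in> carrier G"
        using Rc R by blast+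
      let ?x = "inv g \<otimes> y \<otimes> g"
      have x: "?x \<in> ?F"
        using normal.inv_op_closed1[OF F g yF] .
      have "g \<otimes> ?x \<otimes> inv g = y"
        using g yc by (simp add: m_assoc) (simp flip: m_assoc)
      moreover from this have "?x \<in> ?R"
        using conj[OF x] y by simp
      ultimately show "y \<in> g <# ?R #> inv g"
        unfolding r_coset_def l_coset_def by force
    qed
  qed
  with g Rc show ?thesis
    by (simp add: normalizer_def stabilizer_def)
qed

text \<open>If \<open>g H\<close> meets only finitely many right cosets of \<open>H\<close>, then \<open>H\<close> is covered by finitely many right
  cosets of its conjugate \<open>H\<^sup>g\<close>.\<close>

lemma (in group) subset_radical_conj_subgroup_of_finite_support:
  assumes H: "subgroup H G" and g: "g \<in> carrier G"
    and S: "finite S" "S \<subseteq> carrier G" "\<And>h. h \<in> H \<Longrightarrow> g \<otimes> h \<in> (\<Union>s\<in>S. H #> s)"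
  shows "H \<subseteq> radical G (carrier G) (conj_subgroup G H g)"
proof -
  have Hc: "H \<subseteq> carrier G" using H by (rule subgroup.subset)
  have "H \<subseteq> conj_subgroup G H g <#> (\<lambda>s. inv g \<otimes> s) ` S"
  proof
    fix h assume h: "h \<in> H"
    then obtain s h' where s: "s \<in> S" "h' \<in> H" "g \<otimes> h = h' \<otimes> s"
      using S(3)[OF h] by (auto simp: r_coset_def)
    have c: "h \<in> carrier G" "h' \<in> carrier G" "s \<in> carrier G"
      using h s(1,2) Hc S(2) by auto
    have "h = inv g \<otimes> (g \<otimes> h)"
      using c g by (simp flip: m_assoc)
    also have "\<dots> = (inv g \<otimes> h' \<otimes> g) \<otimes> (inv g \<otimes> s)"
      using c g by (simp add: s(3) m_assoc) (simp flip: m_assoc)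
    finally show "h \<in> conj_subgroup G H g <#> (\<lambda>s. inv g \<otimes> s) ` S"
      using s(1,2) by (auto simp: set_mult_def conj_subgroup_def)
  qed
  moreover have "finite ((\<lambda>s. inv g \<otimes> s) ` S)" "(\<lambda>s. inv g \<otimes> s) ` S \<subseteq> carrier G"
    using S(1,2) g by auto
  ultimately show ?thesis
    using subset_radical_of_finite_coset_cover[OF subgroup_conj_subgroup[OF H g] H] by blast
qed

section \<open>The induced representation of a character\<close>

lemma (in group) character_onD:
  assumes "subgroup H G" "character_on G H \<chi>"
  shows "\<lbrakk>h \<in> H; h' \<in> H\<rbrakk> \<Longrightarrow> \<chi> (h \<otimes> h') = \<chi> h * \<chi> h'"
    and "h \<in> H \<Longrightarrow> \<chi> h \<noteq> 0"
    and "\<chi> \<one> = 1"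
proof -
  show mult: "\<chi> (h \<otimes> h') = \<chi> h * \<chi> h'" if "h \<in> H" "h' \<in> H" for h h'
    using assms(2) that by (simp add: character_on_def hom_def complex_units_def)
  show nz: "\<chi> h \<noteq> 0" if "h \<in> H" for h
    using assms(2) that by (auto simp: character_on_def hom_def complex_units_def)
  show "\<chi> \<one> = 1"
    using mult[of \<one> \<one>] nz[of \<one>] subgroup.one_closed[OF assms(1)] by simp
qed

text \<open>The function \<open>\<delta>\<close> in the induced representation that extends \<open>\<chi>\<close> by zero; it generates the
  induced representation.\<close>

definition ind_delta :: "'a set \<Rightarrow> ('a \<Rightarrow> complex) \<Rightarrow> 'a \<Rightarrow> complex" where
  "ind_delta H \<chi> x = (if x \<in> H then \<chi> x else 0)"

lemma (in group) subgroup_mult_left_iff: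
  assumes "subgroup H G" "h \<in> H" "x \<in> carrier G"
  shows "h \<otimes> x \<in> H \<longleftrightarrow> x \<in> H"
proof
  have h: "h \<in> carrier G" using assms(1,2) by (rule subgroup.mem_carrier)
  assume "h \<otimes> x \<in> H"
  then have "inv h \<otimes> (h \<otimes> x) \<in> H"
    using assms by (simp add: subgroup.m_closed subgroup.m_inv_closed)
  then show "x \<in> H" using h assms(3) by (simp flip: m_assoc)
qed (use assms in \<open>simp add: subgroup.m_closed\<close>)

lemma (in group) subgroup_mult_right_iff:
  assumes "subgroup H G" "h \<in> H" "x \<in> carrier G"
  shows "x \<otimes> h \<in> H \<longleftrightarrow> x \<in> H"
proof
  have h: "h \<in> carrier G" using assms(1,2) by (rule subgroup.mem_carrier)
  assume "x \<otimes> h \<in> H"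
  then have "x \<otimes> h \<otimes> inv h \<in> H"
    using assms by (simp add: subgroup.m_closed subgroup.m_inv_closed)
  then show "x \<in> H" using h assms(3) by (simp add: m_assoc)
qed (use assms in \<open>simp add: subgroup.m_closed\<close>)

lemma (in group) ind_delta_in_ind_space:
  assumes H: "subgroup H G" and \<chi>: "character_on G H \<chi>"
  shows "ind_delta H \<chi> \<in> ind_space G H UNIV (char_action \<chi>)"
proof (rule ind_spaceI[where S = "{\<one>}"])
  show "ind_delta H \<chi> x = 0" if "x \<notin> carrier G" for x
    using that subgroup.mem_carrier[OF H] by (auto simp: ind_delta_def)
  show "ind_delta H \<chi> (h \<otimes> x) = char_action \<chi> h (ind_delta H \<chi> x)" if "h \<in> H" "x \<in> carrier G" for h x
    using that character_onD(1)[OF H \<chi>] subgroup_mult_left_iff[OF H]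
    by (simp add: ind_delta_def char_action_def)
  show "{x. ind_delta H \<chi> x \<noteq> 0} \<subseteq> (\<Union>s\<in>{\<one>}. H #> s)"
    using subgroup.subset[OF H] by (auto simp: ind_delta_def split: if_splits)
qed simp_all

lemma (in group) ind_action_ind_delta:
  assumes H: "subgroup H G" and \<chi>: "character_on G H \<chi>" and h: "h \<in> H"
  shows "ind_action G h (ind_delta H \<chi>) = fun_scale (*) (\<chi> h) (ind_delta H \<chi>)"
  using character_onD(1)[OF H \<chi>] subgroup_mult_right_iff[OF H h] subgroup.mem_carrier[OF H] h
  by (auto simp: fun_eq_iff ind_action_def fun_scale_def ind_delta_def)

text \<open>An \<open>H\<close>-eigenvector of the induced representation with eigencharacter \<open>\<chi>\<close> can be nonzero
  at \<open>g\<close> only if \<open>\<chi>\<close> and its conjugate agree on the common domain.\<close>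

lemma (in group) conj_character_eq_of_eigenvector:
  assumes H: "subgroup H G" and \<phi>: "\<phi> \<in> ind_space G H UNIV (char_action \<chi>)"
    and eig: "\<And>h x. \<lbrakk>h \<in> H; x \<in> carrier G\<rbrakk> \<Longrightarrow> \<phi> (x \<otimes> h) = \<chi> h * \<phi> x"
    and g: "g \<in> carrier G" "\<phi> g \<noteq> 0" and x: "x \<in> conj_subgroup G H g \<inter> H"
  shows "conj_character G \<chi> g x = \<chi> x"
proof -
  have xc: "x \<in> carrier G" using x subgroup.mem_carrier[OF H] by blast
  have "g \<otimes> x \<otimes> inv g \<in> H"
    using x mem_conj_subgroup_iff[OF subgroup.subset[OF H] g(1) xc] by simp
  then have "\<phi> (g \<otimes> x \<otimes> inv g \<otimes> g) = \<chi> (g \<otimes> x \<otimes> inv g) * \<phi> g"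
    using ind_spaceD(3)[OF \<phi> _ g(1)] by (simp add: char_action_def)
  also have "g \<otimes> x \<otimes> inv g \<otimes> g = g \<otimes> x"
    using g(1) xc by (simp add: m_assoc)
  also have "\<phi> (g \<otimes> x) = \<chi> x * \<phi> g"
    using eig x g(1) by simp
  finally show ?thesis
    using g(2) by (simp add: conj_character_def)
qed

text \<open>The finite support condition in the induced representation bounds the right cosets of \<open>H\<close> that
  meet \<open>g H\<close>.\<close>

lemma (in group) eigenvector_support_commensurates:
  assumes H: "subgroup H G" and \<chi>: "character_on G H \<chi>"
    and \<phi>: "\<phi> \<in> ind_space G H UNIV (char_action \<chi>)"
    and eig: "\<And>h x. \<lbrakk>h \<in> H; x \<in> carrier G\<rbrakk> \<Longrightarrow> \<phi> (x \<otimes> h) = \<chi> h * \<phi> x"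
    and g: "g \<in> carrier G" "\<phi> g \<noteq> 0"
  shows "H \<subseteq> radical G (carrier G) (conj_subgroup G H g)"
proof -
  obtain S where S: "finite S" "S \<subseteq> carrier G" "{x. \<phi> x \<noteq> 0} \<subseteq> (\<Union>s\<in>S. H #> s)"
    using ind_spaceD(4)[OF \<phi>] by blast
  have "\<phi> (g \<otimes> h) \<noteq> 0" if "h \<in> H" for h
    using eig[OF that g(1)] character_onD(2)[OF H \<chi> that] g(2) by simp
  then have "g \<otimes> h \<in> (\<Union>s\<in>S. H #> s)" if "h \<in> H" for h
    using S(3) that by blast
  then show ?thesis
    using subset_radical_conj_subgroup_of_finite_support[OF H g(1) S(1,2)] by blast
qed

lemma (in group) eigenvector_eq_scaled_ind_delta:
  assumes H: "subgroup H G" and \<chi>: "character_on G H \<chi>"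
    and \<phi>: "\<phi> \<in> ind_space G H UNIV (char_action \<chi>)"
    and supp: "\<And>g. \<lbrakk>g \<in> carrier G; \<phi> g \<noteq> 0\<rbrakk> \<Longrightarrow> g \<in> H"
  shows "\<phi> = fun_scale (*) (\<phi> \<one>) (ind_delta H \<chi>)"
proof
  fix x
  show "\<phi> x = fun_scale (*) (\<phi> \<one>) (ind_delta H \<chi>) x"
  proof (cases "x \<in> H")
    case True
    then have "\<phi> (x \<otimes> \<one>) = \<chi> x * \<phi> \<one>"
      using ind_spaceD(3)[OF \<phi>, of x \<one>] by (simp add: char_action_def)
    with True show ?thesis
      using subgroup.mem_carrier[OF H] by (simp add: fun_scale_def ind_delta_def)
  next
    case False
    then show ?thesis
      using supp ind_spaceD(2)[OF \<phi>] by (auto simp: fun_scale_def ind_delta_def)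
  qed
qed

text \<open>Since the translates of \<^const>\<open>ind_delta\<close> span the induced representation, an endomorphism that
  scales \<^const>\<open>ind_delta\<close> is scalar. The proof peels off one coset of the support at a time.\<close>

lemma (in group) rep_End_eq_scale_of_ind_delta:
  assumes H: "subgroup H G" and \<chi>: "character_on G H \<chi>"
    and T: "T \<in> rep_End G (fun_scale (*)) (ind_space G H UNIV (char_action \<chi>)) (ind_action G)"
    and T\<delta>: "T (ind_delta H \<chi>) = fun_scale (*) c (ind_delta H \<chi>)"
    and f: "f \<in> ind_space G H UNIV (char_action \<chi>)"
  shows "T f = fun_scale (*) c f"
proof -
  let ?V = "ind_space G H UNIV (char_action \<chi>)"
  interpret I: group_representation G "fun_scale (*)" ?V "ind_action G"
    using representation_ind[OF H representation_char_action[OF H \<chi>]] .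
  have Tadd: "T (v + w) = T v + T w" if "v \<in> ?V" "w \<in> ?V" for v w
    using T that unfolding rep_End_def by blast
  have Tsc: "T (fun_scale (*) d v) = fun_scale (*) d (T v)" if "v \<in> ?V" for d v
    using T that unfolding rep_End_def by blast
  have Tact: "T (ind_action G g v) = ind_action G g (T v)" if "v \<in> ?V" "g \<in> carrier G" for g v
    using T that unfolding rep_End_def by blast
  have \<delta>: "ind_delta H \<chi> \<in> ?V" using H \<chi> by (rule ind_delta_in_ind_space)
  obtain S where S: "finite S" "S \<subseteq> carrier G" "{x. f x \<noteq> 0} \<subseteq> (\<Union>s\<in>S. H #> s)"
    using ind_spaceD(4)[OF f] by blast
  from S f show ?thesis
  proof (induction S arbitrary: f rule: finite_induct)
    case empty
    then have "f = fun_scale (*) 0 f" by (auto simp: fun_scale_def fun_eq_iff)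
    moreover have "T (fun_scale (*) 0 f) = fun_scale (*) 0 (T f)"
      using Tsc empty.prems(3) .
    moreover have "fun_scale (*) 0 (T f) = fun_scale (*) c (fun_scale (*) 0 f)"
      by (simp add: fun_scale_def fun_eq_iff)
    ultimately show ?case by metis
  next
    case (insert s S)
    have s: "s \<in> carrier G" using insert.prems(1) by blast
    \<comment> \<open>The translate \<open>w\<close> of \<open>\<delta>\<close> is supported on \<open>H s\<close> with \<open>w s = 1\<close>; subtracting \<open>f s\<close> times \<open>w\<close>
      removes the coset \<open>H s\<close> from the support of \<open>f\<close>.\<close>
    define w where "w = ind_action G (inv s) (ind_delta H \<chi>)"
    define f' where "f' = f + fun_scale (*) (- f s) w"
    have w: "w \<in> ?V"
      unfolding w_def using s \<delta> by (simp add: I.action_closed)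
    have fs: "fun_scale (*) d w \<in> ?V" for d
      using w I.subspace_V by (rule I.subspace_scale[rotated])
    have f': "f' \<in> ?V"
      unfolding f'_def by (rule I.subspace_add[OF I.subspace_V insert.prems(3) fs])
    have zero: "f' x = 0" if x: "x \<in> H #> s" for x
    proof -
      obtain h where h: "h \<in> H" "x = h \<otimes> s"
        using x by (auto simp: r_coset_def)
      have hc: "h \<in> carrier G" using h(1) subgroup.mem_carrier[OF H] by blast
      have "w x = \<chi> h"
        using h hc s by (simp add: w_def ind_action_def ind_delta_def m_assoc)
      moreover have "f x = \<chi> h * f s"
        using ind_spaceD(3)[OF insert.prems(3) h(1) s] h(2) by (simp add: char_action_def)
      ultimately show ?thesis by (simp add: f'_def fun_scale_def)
    qed
    have supp_w: "x \<in> H #> s" if "w x \<noteq> 0" for x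
    proof -
      have x: "x \<in> carrier G" "x \<otimes> inv s \<in> H"
        using that by (auto simp: w_def ind_action_def ind_delta_def split: if_splits)
      then have "x = (x \<otimes> inv s) \<otimes> s" using s by (simp add: m_assoc)
      with x(2) show ?thesis unfolding r_coset_def by blast
    qed
    have "{x. f' x \<noteq> 0} \<subseteq> (\<Union>s\<in>S. H #> s)"
    proof
      fix x assume "x \<in> {x. f' x \<noteq> 0}"
      then have x: "f' x \<noteq> 0" by simp
      then have "x \<notin> H #> s" using zero by blast
      moreover from this have "f x \<noteq> 0"
        using x supp_w[of x] by (auto simp: f'_def fun_scale_def)
      ultimately show "x \<in> (\<Union>s\<in>S. H #> s)"
        using insert.prems(2) by blast
    qed
    then have IH: "T f' = fun_scale (*) c f'"
      using insert.IH[OF _ _ f'] insert.prems(1) by blast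
    have Tw: "T w = fun_scale (*) c w"
      unfolding w_def using s \<delta> by (simp add: Tact T\<delta> I.action_scale)
    have decomp: "f' + fun_scale (*) (f s) w = f"
      by (simp add: f'_def fun_scale_def fun_eq_iff)
    have "T (f' + fun_scale (*) (f s) w) = T f' + fun_scale (*) (f s) (T w)"
      by (simp only: Tadd[OF f' fs] Tsc[OF w])
    also have "\<dots> = fun_scale (*) c (f' + fun_scale (*) (f s) w)"
      by (simp add: IH Tw fun_scale_def fun_eq_iff algebra_simps)
    finally show ?case by (simp only: decomp)
  qed
qed

section \<open>Schur irreducibility\<close>

text \<open>The nonzero vector \<open>v\<close> guarantees that the identity is a nonzero endomorphism, so that the
  dimension is \<open>1\<close> and not \<open>0\<close>.\<close>

lemma schur_irreducible_if_endomorphisms_scalar: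
  fixes scale :: "complex \<Rightarrow> 'v::ab_group_add \<Rightarrow> 'v"
  assumes rep: "group_representation G scale V \<pi>"
    and v: "v \<in> V" "v \<noteq> 0"
    and scalar: "\<And>T. T \<in> rep_End G scale V \<pi> \<Longrightarrow> \<exists>c. \<forall>w\<in>V. T w = scale c w"
  shows "schur_irreducible G scale V \<pi>"
proof -
  interpret R: group_representation G scale V \<pi> by fact
  interpret E: vector_space "fun_scale scale :: complex \<Rightarrow> ('v \<Rightarrow> 'v) \<Rightarrow> _"
    by (rule vector_space_fun_scale) unfold_locales
  \<comment> \<open>The identity of \<open>V\<close> in the extension-by-zero encoding of \<^const>\<open>rep_End\<close>.\<close>
  define I where "I = (\<lambda>w. if w \<in> V then w else 0)"
  have "I \<in> rep_End G scale V \<pi>"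
    using R.subspace_V by (simp add: I_def rep_End_def R.action_closed R.subspace_add R.subspace_scale)
  moreover have "rep_End G scale V \<pi> \<subseteq> E.span {I}"
  proof
    fix T assume T: "T \<in> rep_End G scale V \<pi>"
    obtain c where c: "\<And>w. w \<in> V \<Longrightarrow> T w = scale c w"
      using scalar[OF T] by blast
    moreover have "T w = 0" if "w \<notin> V" for w
      using T that unfolding rep_End_def by blast
    ultimately have "T = fun_scale scale c I"
      by (auto simp: fun_eq_iff fun_scale_def I_def)
    then show "T \<in> E.span {I}"
      by (simp add: E.span_base E.span_scale)
  qed
  moreover have "I \<noteq> 0"
    using v by (metis I_def zero_fun_apply)
  ultimately have "E.dim (rep_End G scale V \<pi>) = 1"
    by (intro E.dim_unique[of "{I}"]) auto
  with rep show ?thesis by (simp add: schur_irreducible_def)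
qed

theorem theorem1p1:
  fixes G (structure) and H :: "'a set" and \<chi> :: "'a \<Rightarrow> complex"
  assumes "group G"
    and "supersolvable G"
    and "subgroup H G"
    and "character_on G H \<chi>"
    and "\<And>g. g \<in> normalizer G (radical G (fitting_subgroup G) (H \<inter> fitting_subgroup G)) - H \<Longrightarrow>
           restrict (conj_character G \<chi> g) (conj_subgroup G H g \<inter> H)
             \<noteq> restrict \<chi> (conj_subgroup G H g \<inter> H)"
  shows "schur_irreducible G (fun_scale (*)) (ind_space G H UNIV (char_action \<chi>)) (ind_action G)"
proof -
  interpret group G by fact
  note H = assms(3) and \<chi> = assms(4)
  let ?V = "ind_space G H UNIV (char_action \<chi>)" and ?\<delta> = "ind_delta H \<chi>"
  have rep: "group_representation G (fun_scale (*)) ?V (ind_action G)"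
    using representation_ind[OF H representation_char_action[OF H \<chi>]] .
  have \<delta>: "?\<delta> \<in> ?V" using H \<chi> by (rule ind_delta_in_ind_space)
  show ?thesis
  proof (rule schur_irreducible_if_endomorphisms_scalar[OF rep \<delta>])
    have "?\<delta> \<one> = 1"
      using character_onD(3)[OF H \<chi>] subgroup.one_closed[OF H] by (simp add: ind_delta_def)
    then show "?\<delta> \<noteq> 0" by auto
  next
    fix T assume T: "T \<in> rep_End G (fun_scale (*)) ?V (ind_action G)"
    define \<phi> where "\<phi> = T ?\<delta>"
    have \<phi>: "\<phi> \<in> ?V"
      using T \<delta> unfolding rep_End_def \<phi>_def by blast
    have eig: "\<phi> (x \<otimes> h) = \<chi> h * \<phi> x" if h: "h \<in> H" and x: "x \<in> carrier G" for h x
    proof -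
      have "ind_action G h \<phi> = T (ind_action G h ?\<delta>)"
        using T \<delta> subgroup.mem_carrier[OF H h] unfolding rep_End_def \<phi>_def by simp
      also have "\<dots> = fun_scale (*) (\<chi> h) \<phi>"
        using T \<delta> ind_action_ind_delta[OF H \<chi> h] unfolding rep_End_def \<phi>_def by simp
      finally have "ind_action G h \<phi> x = fun_scale (*) (\<chi> h) \<phi> x" by simp
      with x show ?thesis by (simp add: ind_action_def fun_scale_def)
    qed
    have "g \<in> H" if g: "g \<in> carrier G" "\<phi> g \<noteq> 0" for g
    proof (rule ccontr)
      assume "g \<notin> H"
      moreover have "g \<in> normalizer G (radical G (fitting_subgroup G) (H \<inter> fitting_subgroup G))"
        using mem_normalizer_radical_fitting[OF assms(2) H g(1)]
          eigenvector_support_commensurates[OF H \<chi> \<phi> eig g] .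
      moreover have "restrict (conj_character G \<chi> g) (conj_subgroup G H g \<inter> H)
          = restrict \<chi> (conj_subgroup G H g \<inter> H)"
        using conj_character_eq_of_eigenvector[OF H \<phi> eig g] by (intro restrict_ext)
      ultimately show False using assms(5) by blast
    qed
    then have "T ?\<delta> = fun_scale (*) (\<phi> \<one>) ?\<delta>"
      using eigenvector_eq_scaled_ind_delta[OF H \<chi> \<phi>] unfolding \<phi>_def by blast
    then show "\<exists>c. \<forall>w\<in>?V. T w = fun_scale (*) c w"
      using rep_End_eq_scale_of_ind_delta[OF H \<chi> T] by blast
  qed
qed

end
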